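(* Suppose that $\phi:\mathbb R\to\mathbb R$ is non-decreasing and locally Lipschitz continuous, that for some fixed $d'\in\mathbb R$ one has $\phi(x)=0$ for all $x\le d'$, and that, if $X$ has paths of bounded variation, $\phi(x)<c$ for all $x\in\mathbb R$. Then there exists a unique solution $U$ to the stochastic differential equation $$dU(t)=dX(t)-\phi(U(t))\,dt .$$ Furthermore, if $(\phi_n)_{n\ge1}$ is an approximating sequence for $\phi$ and $U_n$ denotes the solution of $dU_n(t)=dX(t)-\phi_n(U_n(t))\,dt$, then $(U_n)_{n\ge1}$ converges to $U$ almost surely, uniformly on compact time intervals.
   Context: $X$ is a spectrally negative Lévy process without monotone paths, with Laplace exponent $\psi(\lambda)=\gamma\lambda+\frac12\sigma^2\lambda^2+\int_0^\infty(e^{-\lambda z}-1+\lambda z\mathbf 1_{(0,1)}(z))\,\Pi(dz)$, $\lambda\ge0$. $X$ has bounded variation paths iff $\sigma=0$ and $\int_0^1z\,\Pi(dz)<\infty$; then $c:=\gamma+\int_0^1z\,\Pi(dz)$ is its drift. An approximating sequence for $\phi$ is a sequence $(\phi_n)_{n\ge1}$ such that: (a) $\phi_n\to\phi$ uniformly on compact sets; (b) $\phi_1(x)\le\phi_2(x)\le\dots\le\phi(x)$ for all $x\in\mathbb R$; (c) for each $n$, $\phi_n(x)=\sum_{j=1}^{m_n}\delta_j^n\mathbf 1_{\{x>b_j^n\}}$ for some $m_n\in\mathbb N$, real numbers $b_1^n<\dots<b_{m_n}^n$ and $\delta_j^n>0$. SDEs are understood in integral form, $U(t)=X(t)-\int_0^t\phi(U(s))\,ds$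 for all $t\ge0$ (so all processes start from $X(0)$), solutions being adapted processes and uniqueness being pathwise. It is known that the SDE with rate $\phi_n$ has a unique strong solution $U_n$. *)

theory Defs
  imports "HOL-Probability.Probability"
begin

section \<open>Path properties\<close>

definition cadlag :: "(real \<Rightarrow> real) \<Rightarrow> bool" where
  "cadlag f \<longleftrightarrow> (\<forall>t\<ge>0. continuous (at_right t) f) \<and> (\<forall>t>0. \<exists>l. (f \<longlongrightarrow> l) (at_left t))"

definition no_positive_jumps :: "(real \<Rightarrow> real) \<Rightarrow> bool" where
  "no_positive_jumps f \<longleftrightarrow> (\<forall>t>0. \<forall>l. (f \<longlongrightarrow> l) (at_left t) \<longrightarrow> f t \<le> l)"

definition bounded_variation_on :: "real \<Rightarrow> real \<Rightarrow> (real \<Rightarrow> real) \<Rightarrow> bool" where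
  "bounded_variation_on a b f \<longleftrightarrow>
     (\<exists>C. \<forall>n (p :: nat \<Rightarrow> real). mono_on {..n} p \<and> p ` {..n} \<subseteq> {a..b} \<longrightarrow>
        (\<Sum>i<n. \<bar>f (p (Suc i)) - f (p i)\<bar>) \<le> C)"

definition has_bounded_variation_paths :: "'a measure \<Rightarrow> (real \<Rightarrow> 'a \<Rightarrow> real) \<Rightarrow> bool" where
  "has_bounded_variation_paths M X \<longleftrightarrow>
     (AE \<omega> in M. \<forall>t\<ge>0. bounded_variation_on 0 t (\<lambda>s. X s \<omega>))"


section \<open>Spectrally negative Levy processes\<close>

text \<open>
  The Levy measure lives on \<open>(0, \<infinity>)\<close>: it describes the sizes of the downward jumps. It is
  represented as a Borel measure on the whole line which does not charge \<open>(-\<infinity>, 0]\<close>.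
\<close>

definition levy_measure :: "real measure \<Rightarrow> bool" where
  "levy_measure \<nu> \<longleftrightarrow> sets \<nu> = sets borel \<and> emeasure \<nu> {..0} = 0 \<and>
     (\<integral>\<^sup>+z. ennreal (min 1 (z\<^sup>2)) \<partial>\<nu>) < \<infinity>"

definition laplace_exponent :: "real \<Rightarrow> real \<Rightarrow> real measure \<Rightarrow> real \<Rightarrow> real" where
  "laplace_exponent \<gamma> \<sigma> \<nu> l = \<gamma> * l + \<sigma>\<^sup>2 * l\<^sup>2 / 2 +
     (LINT z:{0<..}|\<nu>. exp (- l * z) - 1 + l * z * indicator {0<..<1} z)"

text \<open>
  The drift is meaningful only when \<open>z\<close> is \<open>\<nu>\<close>-integrable over \<open>(0, 1)\<close>, which is the case
  whenever the paths have bounded variation.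
\<close>

definition levy_drift :: "real \<Rightarrow> real measure \<Rightarrow> real" where
  "levy_drift \<gamma> \<nu> = \<gamma> + (LINT z:{0<..<1}|\<nu>. z)"

text \<open>
  Processes are indexed by \<open>real\<close>, but only times \<open>t \<ge> 0\<close> matter. The process starts from an
  arbitrary deterministic point \<open>x\<close>, as under the law usually denoted \<open>P\<^sub>x\<close>.
\<close>

locale spectrally_negative_levy = prob_space M + filtration "space M" F
  for M :: "'a measure" and F :: "real \<Rightarrow> 'a measure" +
  fixes X :: "real \<Rightarrow> 'a \<Rightarrow> real" and x \<gamma> \<sigma> :: real and \<nu> :: "real measure"
  assumes subalgebra_F: "\<And>t. 0 \<le> t \<Longrightarrow> subalgebra M (F t)"
    and adapted: "\<And>t. 0 \<le> t \<Longrightarrow> X t \<in> borel_measurable (F t)"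
    and start: "AE \<omega> in M. X 0 \<omega> = x"
    and cadlag_paths: "AE \<omega> in M. cadlag (\<lambda>t. X t \<omega>)"
    and independent_increments: "\<And>s t. 0 \<le> s \<Longrightarrow> s \<le> t \<Longrightarrow>
          indep_set (sets (F s)) (sets (vimage_algebra (space M) (\<lambda>\<omega>. X t \<omega> - X s \<omega>) borel))"
    and stationary_increments: "\<And>s t. 0 \<le> s \<Longrightarrow> s \<le> t \<Longrightarrow>
          distr M borel (\<lambda>\<omega>. X t \<omega> - X s \<omega>) = distr M borel (\<lambda>\<omega>. X (t - s) \<omega> - X 0 \<omega>)"
    and no_positive_jumps_paths: "AE \<omega> in M. no_positive_jumps (\<lambda>t. X t \<omega>)"
    and sigma_nonneg: "0 \<le> \<sigma>"
    and levy_measure: "levy_measure \<nu>"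
    and laplace_transform: "\<And>t l. 0 \<le> t \<Longrightarrow> 0 \<le> l \<Longrightarrow>
          has_bochner_integral M (\<lambda>\<omega>. exp (l * (X t \<omega> - X 0 \<omega>)))
            (exp (t * laplace_exponent \<gamma> \<sigma> \<nu> l))"
    and not_monotone_paths: "AE \<omega> in M. \<not> mono_on {0..} (\<lambda>t. X t \<omega>) \<and>
          \<not> antimono_on {0..} (\<lambda>t. X t \<omega>)"


section \<open>Solutions and approximating sequences\<close>

text \<open>
  Integrability is required explicitly, since the Bochner integral of a non-integrable function
  is \<open>0\<close> by convention.
\<close>

definition sde_solution ::
  "'a measure \<Rightarrow> (real \<Rightarrow> 'a measure) \<Rightarrow> (real \<Rightarrow> 'a \<Rightarrow> real) \<Rightarrow> (real \<Rightarrow> real) \<Rightarrow>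
    (real \<Rightarrow> 'a \<Rightarrow> real) \<Rightarrow> bool" where
  "sde_solution M F X \<phi> U \<longleftrightarrow>
     (\<forall>t\<ge>0. U t \<in> borel_measurable (F t)) \<and>
     (AE \<omega> in M. \<forall>t\<ge>0. set_integrable lborel {0..t} (\<lambda>s. \<phi> (U s \<omega>)) \<and>
        U t \<omega> = X t \<omega> - (LINT s:{0..t}|lborel. \<phi> (U s \<omega>)))"

definition indistinguishable ::
  "'a measure \<Rightarrow> (real \<Rightarrow> 'a \<Rightarrow> real) \<Rightarrow> (real \<Rightarrow> 'a \<Rightarrow> real) \<Rightarrow> bool" where
  "indistinguishable M U V \<longleftrightarrow> (AE \<omega> in M. \<forall>t\<ge>0. U t \<omega> = V t \<omega>)"

definition multi_refracted_rate :: "(real \<Rightarrow> real) \<Rightarrow> bool" where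
  "multi_refracted_rate \<phi> \<longleftrightarrow>
     (\<exists>(m :: nat) (b :: nat \<Rightarrow> real) (\<delta> :: nat \<Rightarrow> real).
        strict_mono_on {1..m} b \<and> (\<forall>j\<in>{1..m}. 0 < \<delta> j) \<and>
        (\<forall>x. \<phi> x = (\<Sum>j=1..m. \<delta> j * indicator {b j<..} x)))"

text \<open>Sequences are indexed from \<open>1\<close>; the value at index \<open>0\<close> is irrelevant.\<close>

definition approximating_sequence :: "(real \<Rightarrow> real) \<Rightarrow> (nat \<Rightarrow> real \<Rightarrow> real) \<Rightarrow> bool" where
  "approximating_sequence \<phi> \<phi>s \<longleftrightarrow>
     (\<forall>K. compact K \<longrightarrow> uniform_limit K \<phi>s \<phi> sequentially) \<and>
     (\<forall>n\<ge>1. \<forall>x. \<phi>s n x \<le> \<phi>s (Suc n) x \<and> \<phi>s n x \<le> \<phi> x) \<and>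
     (\<forall>n\<ge>1. multi_refracted_rate (\<phi>s n))"

end

theory Submission
  imports Defs
begin

text \<open>The argument is pathwise. Along a fixed path, two solutions driven by rates that are
  \<open>\<epsilon>\<close>-close on the range of the first one differ by at most \<open>\<epsilon> t\<close> at time \<open>t\<close>: whenever
  one of them lies above the other, monotonicity of the rate pushes them together up to a speed \<open>\<epsilon>\<close>.
  This gives uniqueness (with \<open>\<epsilon> = 0\<close>) and convergence along approximating sequences. Existence
  is Picard iteration: as \<open>0 \<le> \<phi>\<close> is non-decreasing, all iterates stay in a bounded region, on which
  \<open>\<phi>\<close> is Lipschitz.\<close>

section \<open>Boundedness of cadlag functions and bounded convergence\<close>

text \<open>Right-continuity and left limits bound \<open>f\<close> near each point; Bolzano
  bisection glues these local bounds together over the compact interval.\<close>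

lemma cadlag_bounded:
  assumes f: "cadlag f"
  shows "\<exists>C. \<forall>s\<in>{0..T}. \<bar>f s\<bar> \<le> C"
proof (cases "0 \<le> T")
  case True
  \<comment> \<open>Bolzano's local step quantifies over all short intervals around a point,
    including those reaching below 0, where nothing is known about \<open>f\<close>. The truncation
    \<open>max 0 a\<close> discards that portion.\<close>
  define P where "P a b \<longleftrightarrow> (\<exists>C. \<forall>s\<in>{max 0 a..b}. \<bar>f s\<bar> \<le> C)" for a b :: real
  have "P 0 T"
    using True
  proof (induction rule: Bolzano)
    case (trans a b c)
    then obtain C D where "\<forall>s\<in>{max 0 a..b}. \<bar>f s\<bar> \<le> C" "\<forall>s\<in>{max 0 b..c}. \<bar>f s\<bar> \<le> D"
      unfolding P_def by blast
    then have "\<forall>s\<in>{max 0 a..c}. \<bar>f s\<bar> \<le> max C D"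
      by (auto simp: le_max_iff_disj)
    then show ?case unfolding P_def by blast
  next
    case (local t)
    have "(f \<longlongrightarrow> f t) (at_right t)"
      using f local by (auto simp: cadlag_def continuous_within)
    then have "\<forall>\<^sub>F s in at_right t. dist (f s) (f t) < 1"
      by (rule tendstoD) simp
    then obtain u where u: "u > t" "\<And>s. t < s \<Longrightarrow> s < u \<Longrightarrow> \<bar>f s - f t\<bar> < 1"
      unfolding eventually_at_right_field by (auto simp: dist_real_def)
    have "\<exists>v<t. \<exists>l. \<forall>s. max 0 v < s \<and> s < t \<longrightarrow> \<bar>f s - l\<bar> < 1"
    proof (cases "t = 0")
      case True
      \<comment> \<open>There is no left limit at 0; with \<open>v = -1\<close> the required range
        of \<open>s\<close> is empty.\<close>
      then show ?thesis by (intro exI[of _ "-1"]) auto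
    next
      case False
      then obtain l where "(f \<longlongrightarrow> l) (at_left t)"
        using f local by (force simp: cadlag_def)
      then have "\<forall>\<^sub>F s in at_left t. dist (f s) l < 1"
        by (rule tendstoD) simp
      then show ?thesis
        unfolding eventually_at_left_field by (auto simp: dist_real_def)
    qed
    then obtain v l where v: "v < t" "\<And>s. max 0 v < s \<Longrightarrow> s < t \<Longrightarrow> \<bar>f s - l\<bar> < 1"
      by blast
    \<comment> \<open>The first entry covers \<open>t\<close> and points to its right, the second
      those to its left. The summand \<open>\<bar>f 0\<bar>\<close> is there because the strict
      inequality \<open>max 0 v < s\<close> leaves out \<open>s = 0\<close>.\<close>
    let ?C = "max (\<bar>f t\<bar> + 1) (\<bar>l\<bar> + 1 + \<bar>f 0\<bar>)"
    have bd: "\<bar>f s\<bar> \<le> ?C" if "max 0 v < s \<or> s = 0" "s < u" for s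
      using that u(2)[of s] v(2)[of s] by (cases s t rule: linorder_cases) auto
    show ?case
    proof (intro exI[of _ "min (u - t) (t - v)"] conjI allI impI)
      show "0 < min (u - t) (t - v)" using u v by simp
      fix a b assume *: "a \<le> t \<and> t \<le> b \<and> b - a < min (u - t) (t - v)"
      have "\<forall>s\<in>{max 0 a..b}. \<bar>f s\<bar> \<le> ?C"
        using * by (intro ballI bd) auto
      then show "P a b" unfolding P_def by blast
    qed
  qed
  then show ?thesis by (simp add: P_def)
qed auto

text \<open>Dominated convergence with a constant majorant. Measurability of \<open>g\<close> on the
  interval is inherited from the \<open>h k\<close> through the pointwise limit.\<close>

lemma set_integral_bounded_convergence:
  fixes h :: "nat \<Rightarrow> real \<Rightarrow> real"
  assumes h: "\<And>k. set_integrable lborel {a..b} (h k)"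
    and bound: "\<And>k s. s \<in> {a..b} \<Longrightarrow> \<bar>h k s\<bar> \<le> C"
    and lim: "\<And>s. s \<in> {a..b} \<Longrightarrow> (\<lambda>k. h k s) \<longlonglongrightarrow> g s"
  shows "set_integrable lborel {a..b} g"
    and "(\<lambda>k. LINT s:{a..b}|lborel. h k s) \<longlonglongrightarrow> (LINT s:{a..b}|lborel. g s)"
proof -
  have ptw: "(\<lambda>k. indicator {a..b} s *\<^sub>R h k s) \<longlonglongrightarrow> indicator {a..b} s *\<^sub>R g s" for s
    using lim by (cases "s \<in> {a..b}") auto
  have meas: "(\<lambda>s. indicator {a..b} s *\<^sub>R h k s) \<in> borel_measurable lborel" for k
    using h[of k] unfolding set_integrable_def by (rule borel_measurable_integrable)
  have measg: "(\<lambda>s. indicator {a..b} s *\<^sub>R g s) \<in> borel_measurable lborel"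
    by (rule borel_measurable_LIMSEQ_metric[OF meas ptw])
  have int: "integrable lborel (\<lambda>s. indicator {a..b} s * C)"
    by (intro integrable_mult_left) (auto simp: emeasure_lborel_Icc_eq)
  have bd: "norm (indicator {a..b} s *\<^sub>R h k s) \<le> indicator {a..b} s * C" for k s
    using bound by (auto simp: indicator_def)
  show "set_integrable lborel {a..b} g"
    unfolding set_integrable_def
    by (rule integrable_dominated_convergence[where s = "\<lambda>k s. indicator {a..b} s *\<^sub>R h k s", OF measg meas int];
        intro AE_I2 ptw bd)
  show "(\<lambda>k. LINT s:{a..b}|lborel. h k s) \<longlonglongrightarrow> (LINT s:{a..b}|lborel. g s)"
    unfolding set_lebesgue_integral_def
    by (rule integral_dominated_convergence[where s = "\<lambda>k s. indicator {a..b} s *\<^sub>R h k s", OF measg meas int];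
        intro AE_I2 ptw bd)
qed

section \<open>Riemann sums of right-continuous functions\<close>

text \<open>Right endpoints are sampled so that the sample point tends to a given time from the
  right, the side on which cadlag paths are continuous. No sample point exceeds \<open>t\<close>,
  which later makes the sums measurable at time \<open>t\<close>. Using \<open>Suc n\<close> cells
  avoids division by zero.\<close>

definition riemann_sum :: "(real \<Rightarrow> real) \<Rightarrow> real \<Rightarrow> nat \<Rightarrow> real" where
  "riemann_sum f t n = t / Suc n * (\<Sum>i<Suc n. f (t * Suc i / Suc n))"

text \<open>The sum is the exact integral of a step function taking on each cell the value of
  \<open>f\<close> at its right endpoint. By right-continuity these step functions converge
  pointwise to \<open>f\<close>, and they share its bound, so bounded convergence yields both
  integrability and the limit.\<close>

lemma riemann_sum_tendsto:
  assumes right: "\<And>s. 0 \<le> s \<Longrightarrow> continuous (at_right s) f"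
    and bound: "\<And>s. s \<in> {0..t} \<Longrightarrow> \<bar>f s\<bar> \<le> C"
    and t: "0 \<le> t"
  shows "set_integrable lborel {0..t} f"
    and "riemann_sum f t \<longlonglongrightarrow> (LINT s:{0..t}|lborel. f s)"
proof -
  define A where "A n i = {t * real i / Suc n<..t * Suc i / Suc n}" for n i
  \<comment> \<open>The half-open cells miss 0; the last summand restores the value there without
    changing the integral.\<close>
  define h where "h n s = (\<Sum>i<Suc n. indicator (A n i) s * f (t * Suc i / Suc n)) + indicator {0} s * f 0"
    for n and s :: real
  \<comment> \<open>The right endpoint of the cell containing \<open>s\<close>. At
    \<open>s = 0\<close>, and also when \<open>t = 0\<close>, the formula gives 0.\<close>
  define c where "c n s = t * (of_int \<lceil>Suc n * s / t\<rceil>) / Suc n" for n and s :: real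
  have A_sub: "A n i \<subseteq> {0..t}" if "i < Suc n" for n i
  proof -
    have "t * Suc i \<le> t * Suc n" by (intro mult_left_mono) (use t that in auto)
    then have "t * Suc i / Suc n \<le> t" by (simp add: field_simps)
    moreover have "0 \<le> t * real i / Suc n" using t by simp
    ultimately show ?thesis unfolding A_def by (meson greaterThanAtMost_subseteq_atLeastAtMost_iff)
  qed
  have h_eq: "h n s = f (c n s) \<and> s \<le> c n s \<and> c n s \<le> s + t / Suc n \<and> c n s \<le> t"
    if s: "s \<in> {0..t}" for n and s :: real
  proof (cases "s = 0")
    case True
    then have "s \<notin> A n i" for i using t by (auto simp: A_def not_less)
    then show ?thesis using True t by (simp add: h_def c_def)
  next
    case False
    then have pos: "0 < s" "0 < t" using s by auto
    define j where "j = nat \<lceil>Suc n * s / t\<rceil> - 1"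
    have cpos: "0 < \<lceil>Suc n * s / t\<rceil>" 
      unfolding zero_less_ceiling using pos by (intro divide_pos_pos mult_pos_pos) auto
    then have j: "\<lceil>Suc n * s / t\<rceil> = int (Suc j)" unfolding j_def by simp
    have "Suc n * s \<le> Suc n * t" using s by (intro mult_left_mono) auto
    then have "Suc n * s / t \<le> Suc n" using pos by (simp add: divide_le_eq)
    then have "\<lceil>Suc n * s / t\<rceil> \<le> int (Suc n)" by (simp add: ceiling_le_iff)
    then have jn: "j < Suc n" using j by simp
    have A_iff: "s \<in> A n i \<longleftrightarrow> i = j" for i
    proof -
      have "s \<in> A n i \<longleftrightarrow> real i < Suc n * s / t \<and> Suc n * s / t \<le> real (Suc i)"
        using pos unfolding A_def by (auto simp: field_simps)
      also have "\<dots> \<longleftrightarrow> \<lceil>Suc n * s / t\<rceil> = int (Suc i)"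
        by (auto simp: ceiling_eq_iff)
      finally show ?thesis using j by auto
    qed
    have cj: "c n s = t * Suc j / Suc n" unfolding c_def j by simp
    have "h n s = (\<Sum>i<Suc n. indicator (A n i) s * f (t * Suc i / Suc n))"
      using False by (simp add: h_def del: sum.lessThan_Suc)
    also have "\<dots> = (\<Sum>i<Suc n. if i = j then f (t * Suc i / Suc n) else 0)"
      by (intro sum.cong) (auto simp: indicator_def A_iff)
    also have "\<dots> = f (c n s)" using jn cj by (simp del: sum.lessThan_Suc)
    finally have 1: "h n s = f (c n s)" .
    have sA: "s \<in> A n j" using A_iff by simp
    have "t * Suc j / Suc n = t * real j / Suc n + t / Suc n"
      by (simp add: add_divide_distrib[symmetric] distrib_left)
    then have "c n s = t * real j / Suc n + t / Suc n" unfolding cj .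
    moreover have "t * real j / Suc n < s" "s \<le> c n s" using sA unfolding A_def cj by auto
    moreover have "c n s \<le> t"
    proof -
      have "c n s \<in> A n j" unfolding A_def cj using pos by (auto intro!: divide_strict_right_mono)
      then show ?thesis using A_sub[OF jn] by auto
    qed
    ultimately show ?thesis using 1 by auto
  qed
  have restr: "indicator {0..t} s *\<^sub>R h n s = h n s" for n s
  proof (cases "s \<in> {0..t}")
    case False
    then have "s \<notin> A n i" if "i < Suc n" for i using A_sub[OF that] by auto
    then have "h n s = 0" using False t by (auto simp: h_def simp del: sum.lessThan_Suc intro!: sum.neutral)
    then show ?thesis by simp
  qed simp
  have em: "emeasure lborel (A n i) = ennreal (t / Suc n)" for n i
  proof -
    have "t * real i / Suc n \<le> t * Suc i / Suc n"
      using t by (intro divide_right_mono mult_left_mono) auto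
    then have "emeasure lborel (A n i) = ennreal (t * Suc i / Suc n - t * real i / Suc n)"
      unfolding A_def by (rule emeasure_lborel_Ioc)
    also have "t * Suc i / Suc n - t * real i / Suc n = t / Suc n"
      by (simp add: diff_divide_distrib[symmetric] right_diff_distrib[symmetric])
    finally show ?thesis .
  qed
  have "has_bochner_integral lborel (h n)
      ((\<Sum>i<Suc n. measure lborel (A n i) * f (t * Suc i / Suc n)) + measure lborel {0::real} * f 0)" for n
    unfolding h_def[abs_def]
    by (intro has_bochner_integral_add has_bochner_integral_sum has_bochner_integral_mult_left
        has_bochner_integral_real_indicator) (simp_all add: em, simp_all add: A_def)
  moreover have "measure lborel (A n i) = t / Suc n" for n i
    unfolding measure_def em using t by simp
  ultimately have bochner: "has_bochner_integral lborel (h n) (riemann_sum f t n)" for n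
    by (simp add: riemann_sum_def sum_distrib_left del: sum.lessThan_Suc)
  have int_h: "set_integrable lborel {0..t} (h n)" for n
    using bochner[of n] unfolding set_integrable_def restr by (simp add: has_bochner_integral_iff)
  have lint_h: "(LINT s:{0..t}|lborel. h n s) = riemann_sum f t n" for n
    using bochner[of n] unfolding set_lebesgue_integral_def restr by (simp add: has_bochner_integral_iff)
  have bd: "\<bar>h n s\<bar> \<le> C" if "s \<in> {0..t}" for n s
    using h_eq[OF that, of n] bound[of "c n s"] that by auto
  have lim: "(\<lambda>n. h n s) \<longlonglongrightarrow> f s" if s: "s \<in> {0..t}" for s
  proof (rule tendstoI)
    fix e :: real assume e: "e > 0"
    have "(f \<longlongrightarrow> f s) (at_right s)"
      using right s by (auto simp: continuous_within)
    then have "\<forall>\<^sub>F r in at_right s. dist (f r) (f s) < e"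
      using e by (rule tendstoD)
    then obtain u where u: "u > s" "\<And>r. s < r \<Longrightarrow> r < u \<Longrightarrow> dist (f r) (f s) < e"
      unfolding eventually_at_right_field by auto
    have "(\<lambda>n. t / Suc n) \<longlonglongrightarrow> 0"
      by (rule lim_const_over_n[THEN LIMSEQ_Suc])
    then have "\<forall>\<^sub>F n in sequentially. t / Suc n < u - s"
      by (rule order_tendstoD) (use u in simp)
    then show "\<forall>\<^sub>F n in sequentially. dist (h n s) (f s) < e"
    proof eventually_elim
      case (elim n)
      \<comment> \<open>Either \<open>s\<close> is itself a grid point and
        \<open>h n s = f s\<close>, or \<open>c n s\<close> lies strictly between \<open>s\<close>
        and \<open>u\<close>.\<close>
      show ?case using h_eq[OF s, of n] elim u(2)[of "c n s"] e
        by (cases "c n s = s") auto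
    qed
  qed
  show "set_integrable lborel {0..t} f"
    by (rule set_integral_bounded_convergence(1)[OF int_h bd lim])
  show "riemann_sum f t \<longlonglongrightarrow> (LINT s:{0..t}|lborel. f s)"
    using set_integral_bounded_convergence(2)[OF int_h bd lim] by (simp add: lint_h)
qed

section \<open>Comparison of solutions along a fixed path\<close>

text \<open>Let \<open>r\<close> be the last time at which the continuous function \<open>D\<close>
  is at most 0. After \<open>r\<close> the integrand is bounded by \<epsilon>, so \<open>D\<close>
  gains at most \<epsilon> times the remaining time. Working with integrals avoids any
  differentiability of \<open>D\<close>.\<close>

lemma integral_le_of_le_on_pos:
  fixes D g :: "real \<Rightarrow> real"
  assumes g: "g integrable_on {0..t}"
    and D: "\<And>s. s \<in> {0..t} \<Longrightarrow> D s = integral {0..s} g"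
    and le: "\<And>s. s \<in> {0..t} \<Longrightarrow> 0 < D s \<Longrightarrow> g s \<le> \<epsilon>"
    and t: "0 \<le> t" and \<epsilon>: "0 \<le> \<epsilon>"
  shows "D t \<le> \<epsilon> * t"
proof -
  have "continuous_on {0..t} (\<lambda>s. integral {0..s} g)"
    by (rule indefinite_integral_continuous_1[OF g])
  then have contD: "continuous_on {0..t} D"
    by (rule continuous_on_eq) (simp add: D)
  define S where "S = {s \<in> {0..t}. D s \<le> 0}"
  have "D 0 = 0" using D[of 0] t by simp
  then have "0 \<in> S" using t by (simp add: S_def)
  moreover have "S = {0..t} \<inter> D -` {..0}" by (auto simp: S_def)
  then have "closed S" using continuous_closed_preimage[OF contD] by auto
  moreover have bdd: "bdd_above S" by (rule bdd_aboveI[of _ t]) (auto simp: S_def)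
  ultimately have r: "Sup S \<in> S" using closed_contains_Sup[of S] by blast
  define r where "r = Sup S"
  have r0: "0 \<le> r" "r \<le> t" "D r \<le> 0" using r by (auto simp: S_def r_def)
  have after: "0 < D s" if "r < s" "s \<le> t" for s
  proof (rule ccontr)
    assume "\<not> 0 < D s"
    then have "s \<in> S" using that r0 by (auto simp: S_def)
    then show False using cSup_upper[OF _ bdd, of s] that by (simp add: r_def)
  qed
  have g': "g integrable_on {r..t}"
    using g by (rule integrable_on_subinterval) (use r0 in auto)
  \<comment> \<open>The bound on \<open>g\<close> holds only strictly after \<open>r\<close>;
    changing the value at this single point leaves the integral unaltered.\<close>
  define k where "k s = (if s = r then \<epsilon> else g s)" for s
  have k: "k integrable_on {r..t}" "integral {r..t} g = integral {r..t} k"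
    using integrable_spike[OF g', of "{r}" k] integral_spike[of "{r}" "{r..t}" k g]
    by (auto simp: k_def)
  have "D t = integral {0..r} g + integral {r..t} g"
    using Henstock_Kurzweil_Integration.integral_combine[OF r0(1,2) g] D[of t] t by simp
  also have "integral {0..r} g = D r" using D[of r] r0 by simp
  also have "integral {r..t} g \<le> integral {r..t} (\<lambda>_. \<epsilon>)"
    unfolding k(2) by (rule integral_le[OF k(1)]) (use le after r0 in \<open>auto simp: k_def\<close>)
  also have "\<dots> = \<epsilon> * (t - r)" using r0 by simp
  also have "\<dots> \<le> \<epsilon> * t" using \<epsilon> r0 by (intro mult_left_mono) auto
  finally show ?thesis using r0 by simp
qed

definition path_solution :: "(real \<Rightarrow> real) \<Rightarrow> (real \<Rightarrow> real) \<Rightarrow> (real \<Rightarrow> real) \<Rightarrow> bool" where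
  "path_solution \<phi> x u \<longleftrightarrow> (\<forall>t\<ge>0. set_integrable lborel {0..t} (\<lambda>s. \<phi> (u s)) \<and>
     u t = x t - (LINT s:{0..t}|lborel. \<phi> (u s)))"

text \<open>Translates to the Henstock-Kurzweil integral, for which the additivity and continuity
  results used below are stated.\<close>

lemma path_solutionD:
  assumes "path_solution \<phi> x u" "0 \<le> t"
  shows "(\<lambda>s. \<phi> (u s)) integrable_on {0..t}" "u t = x t - integral {0..t} (\<lambda>s. \<phi> (u s))"
  using assms set_borel_integral_eq_integral[of "{0..t}" "\<lambda>s. \<phi> (u s)"]
  by (auto simp: path_solution_def)

text \<open>The driving path, with all its jumps, cancels in the difference, which is therefore an
  indefinite integral. Closeness of the rates is required along \<open>u\<close> only: when
  \<open>u\<close> is fixed and \<open>v\<close> varies, a single range has to be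
  controlled.\<close>

lemma path_solution_comparison:
  assumes u: "path_solution \<phi> x u" and v: "path_solution \<eta> x v" and mono: "mono \<eta>"
    and close: "\<And>s. s \<in> {0..t} \<Longrightarrow> \<bar>\<eta> (u s) - \<phi> (u s)\<bar> \<le> \<epsilon>"
    and t: "0 \<le> t"
  shows "\<bar>v t - u t\<bar> \<le> \<epsilon> * t"
proof -
  note iu = path_solutionD[OF u] and iv = path_solutionD[OF v]
  have \<epsilon>: "0 \<le> \<epsilon>" using close[of 0] t by auto
  have "u t - v t \<le> \<epsilon> * t"
  proof (rule integral_le_of_le_on_pos[where D = "\<lambda>s. u s - v s" and g = "\<lambda>s. \<eta> (v s) - \<phi> (u s)"])
    show "(\<lambda>s. \<eta> (v s) - \<phi> (u s)) integrable_on {0..t}"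
      by (intro integrable_diff iu iv t)
    show "u s - v s = integral {0..s} (\<lambda>s. \<eta> (v s) - \<phi> (u s))" if "s \<in> {0..t}" for s
      using that iu[of s] iv[of s] by (subst Henstock_Kurzweil_Integration.integral_diff) auto
    show "\<eta> (v s) - \<phi> (u s) \<le> \<epsilon>" if "s \<in> {0..t}" "0 < u s - v s" for s
      using close[OF that(1)] monoD[OF mono, of "v s" "u s"] that(2) by auto
  qed (use t \<epsilon> in auto)
  moreover have "v t - u t \<le> \<epsilon> * t"
  proof (rule integral_le_of_le_on_pos[where D = "\<lambda>s. v s - u s" and g = "\<lambda>s. \<phi> (u s) - \<eta> (v s)"])
    show "(\<lambda>s. \<phi> (u s) - \<eta> (v s)) integrable_on {0..t}"
      by (intro integrable_diff iu iv t)
    show "v s - u s = integral {0..s} (\<lambda>s. \<phi> (u s) - \<eta> (v s))" if "s \<in> {0..t}" for s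
      using that iu[of s] iv[of s] by (subst Henstock_Kurzweil_Integration.integral_diff) auto
    show "\<phi> (u s) - \<eta> (v s) \<le> \<epsilon>" if "s \<in> {0..t}" "0 < v s - u s" for s
      using close[OF that(1)] monoD[OF mono, of "u s" "v s"] that(2) by auto
  qed (use t \<epsilon> in auto)
  ultimately show ?thesis by simp
qed

lemma path_solution_unique:
  assumes "path_solution \<phi> x u" "path_solution \<phi> x v" "mono \<phi>" "0 \<le> t"
  shows "v t = u t"
  using path_solution_comparison[OF assms(1-3), of t 0] assms(4) by auto

text \<open>The integral part of a solution is continuous, hence bounded on compacts, and so is the
  cadlag driver.\<close>

lemma path_solution_bounded:
  assumes u: "path_solution \<phi> x u" and x: "cadlag x"
  shows "\<exists>C. \<forall>s\<in>{0..T}. \<bar>u s\<bar> \<le> C"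
proof (cases "0 \<le> T")
  case True
  have "continuous_on {0..T} (\<lambda>t. integral {0..t} (\<lambda>s. \<phi> (u s)))"
    by (rule indefinite_integral_continuous_1) (rule path_solutionD[OF u True])
  then have "bounded ((\<lambda>t. integral {0..t} (\<lambda>s. \<phi> (u s))) ` {0..T})"
    by (intro compact_imp_bounded compact_continuous_image) auto
  then obtain C where C: "\<And>t. t \<in> {0..T} \<Longrightarrow> \<bar>integral {0..t} (\<lambda>s. \<phi> (u s))\<bar> \<le> C"
    unfolding bounded_iff by force
  obtain B where B: "\<forall>s\<in>{0..T}. \<bar>x s\<bar> \<le> B" using cadlag_bounded[OF x] by blast
  have "\<bar>u s\<bar> \<le> B + C" if "s \<in> {0..T}" for s
    using path_solutionD(2)[OF u, of s] B[rule_format, OF that] C[OF that] that by auto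
  then show ?thesis by blast
qed auto

text \<open>The limit solution stays in one compact set on \<open>{0..T}\<close>, so uniform
  convergence of the rates there feeds the comparison estimate simultaneously for all times.\<close>

lemma path_solutions_uniform_limit:
  assumes u: "path_solution \<phi> x u" and x: "cadlag x"
    and us: "\<And>n. 1 \<le> n \<Longrightarrow> path_solution (\<phi>s n) x (us n)"
    and mono: "\<And>n. 1 \<le> n \<Longrightarrow> mono (\<phi>s n)"
    and conv: "\<And>K. compact K \<Longrightarrow> uniform_limit K \<phi>s \<phi> sequentially"
    and T: "0 \<le> T"
  shows "uniform_limit {0..T} us u sequentially"
proof (rule uniform_limitI)
  fix e :: real assume e: "0 < e"
  obtain C where C: "\<forall>s\<in>{0..T}. \<bar>u s\<bar> \<le> C" using path_solution_bounded[OF u x] by blast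
  \<comment> \<open>Dividing by \<open>T + 1\<close> covers \<open>T = 0\<close> and gives the
    strict bound \<open>d * T < e\<close>.\<close>
  define d where "d = e / (T + 1)"
  have d: "0 < d" "d * T < e" using e T by (auto simp: d_def field_simps)
  have "\<forall>\<^sub>F n in sequentially. \<forall>y\<in>{-C..C}. dist (\<phi>s n y) (\<phi> y) < d"
    using conv[of "{-C..C}"] d by (auto dest: uniform_limitD)
  then show "\<forall>\<^sub>F n in sequentially. \<forall>t\<in>{0..T}. dist (us n t) (u t) < e"
    using eventually_ge_at_top[of 1]
  proof eventually_elim
    case (elim n)
    show ?case
    proof
      fix t assume t: "t \<in> {0..T}"
      have "\<bar>us n t - u t\<bar> \<le> d * t"
      proof (rule path_solution_comparison[OF u us mono])
        fix s assume "s \<in> {0..t}"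
        then have "u s \<in> {-C..C}" using C t by (force simp: abs_le_iff)
        then show "\<bar>\<phi>s n (u s) - \<phi> (u s)\<bar> \<le> d" using elim(1) by (auto simp: dist_real_def less_imp_le)
      qed (use t elim in auto)
      also have "\<dots> \<le> d * T" using t d by (intro mult_left_mono) auto
      finally show "dist (us n t) (u t) < e" using d by (simp add: dist_real_def)
    qed
  qed
qed

section \<open>Picard iteration for the integral part of the solution\<close>

text \<open>The time integral is written as a limit of Riemann sums because a Bochner integral over time
  need not be measurable with respect to \<open>F t\<close>: the filtration may be incomplete and the paths are
  cadlag only almost surely.\<close>

primrec picard :: "(real \<Rightarrow> real) \<Rightarrow> (real \<Rightarrow> real) \<Rightarrow> nat \<Rightarrow> real \<Rightarrow> real" where
  "picard \<phi> x 0 = (\<lambda>t. 0)"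
| "picard \<phi> x (Suc k) = (\<lambda>t. lim (riemann_sum (\<lambda>s. \<phi> (x s - picard \<phi> x k s)) t))"

text \<open>The iterates approximate the continuous part \<open>x - u\<close> rather than
  \<open>u\<close>. If one iterate is continuous, its integrand is right-continuous and locally
  bounded, so the Riemann sums converge; the next iterate is then an indefinite integral, hence
  again continuous.\<close>

lemma picard_Suc_eq:
  assumes x: "cadlag x" and \<phi>: "continuous_on UNIV \<phi>"
  defines "h \<equiv> \<lambda>k s. \<phi> (x s - picard \<phi> x k s)"
  shows "0 \<le> t \<Longrightarrow> set_integrable lborel {0..t} (h k)"
    and "0 \<le> t \<Longrightarrow> picard \<phi> x (Suc k) t = (LINT s:{0..t}|lborel. h k s)"
proof -
  have step: "set_integrable lborel {0..t} (h k) \<and> 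
      picard \<phi> x (Suc k) t = (LINT s:{0..t}|lborel. h k s)"
    if cont: "\<And>T. continuous_on {0..T} (picard \<phi> x k)" and t: "0 \<le> t" for k t
  proof -
    have right: "continuous (at_right s) (h k)" if s: "0 \<le> s" for s
    proof -
      have "continuous (at s within {0..s + 1}) (picard \<phi> x k)"
        using cont[of "s + 1"] s by (auto simp: continuous_on_eq_continuous_within)
      then have "continuous (at s within {s..s + 1}) (picard \<phi> x k)"
        by (rule continuous_within_subset) (use s in auto)
      then have "continuous (at_right s) (picard \<phi> x k)"
        by (simp add: at_within_Icc_at_right)
      moreover have "continuous (at_right s) x" using x s by (auto simp: cadlag_def)
      ultimately have "continuous (at_right s) (\<lambda>s. x s - picard \<phi> x k s)"
        by (intro continuous_intros)
      moreover have "isCont \<phi> (x s - picard \<phi> x k s)"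
        using \<phi> by (simp add: continuous_on_eq_continuous_at)
      ultimately show ?thesis unfolding h_def by (rule continuous_within_compose3[rotated])
    qed
    obtain B where B: "\<forall>s\<in>{0..t}. \<bar>x s\<bar> \<le> B" using cadlag_bounded[OF x] by blast
    have "bounded (picard \<phi> x k ` {0..t})"
      by (intro compact_imp_bounded compact_continuous_image cont) auto
    then obtain C where C: "\<And>s. s \<in> {0..t} \<Longrightarrow> \<bar>picard \<phi> x k s\<bar> \<le> C"
      unfolding bounded_iff by force
    have "bounded (\<phi> ` {-B - C..B + C})"
      by (intro compact_imp_bounded compact_continuous_image continuous_on_subset[OF \<phi>]) auto
    then obtain E where E: "\<And>y. y \<in> {-B - C..B + C} \<Longrightarrow> \<bar>\<phi> y\<bar> \<le> E"
      unfolding bounded_iff by force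
    have bd: "\<bar>h k s\<bar> \<le> E" if "s \<in> {0..t}" for s
      unfolding h_def using B[rule_format, OF that] C[OF that] by (intro E) auto
    have "set_integrable lborel {0..t} (h k)"
      by (rule riemann_sum_tendsto(1)[OF right bd t])
    moreover have "riemann_sum (h k) t \<longlonglongrightarrow> (LINT s:{0..t}|lborel. h k s)"
      by (rule riemann_sum_tendsto(2)[OF right bd t])
    ultimately show ?thesis by (auto simp: h_def limI)
  qed
  have cont: "continuous_on {0..T} (picard \<phi> x k)" for k T
  proof (induction k arbitrary: T)
    case (Suc k)
    show ?case
    proof (cases "0 \<le> T")
      case True
      show ?thesis
      proof (rule continuous_on_eq)
        show "continuous_on {0..T} (\<lambda>t. integral {0..t} (h k))"
          using step[OF Suc.IH True]
          by (intro indefinite_integral_continuous_1 set_borel_integral_eq_integral) auto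
        show "integral {0..t} (h k) = picard \<phi> x (Suc k) t" if "t \<in> {0..T}" for t
          using step[OF Suc.IH, of t] that set_borel_integral_eq_integral(2)[of "{0..t}" "h k"] by auto
      qed
    qed simp
  qed simp
  show "0 \<le> t \<Longrightarrow> set_integrable lborel {0..t} (h k)"
    "0 \<le> t \<Longrightarrow> picard \<phi> x (Suc k) t = (LINT s:{0..t}|lborel. h k s)"
    using step[OF cont] by auto
qed

text \<open>Confinement of the iterates reduces local to global Lipschitz continuity on each time
  interval. Successive differences then decay like the terms of an exponential series, and the limit
  inherits the integral equation.\<close>

lemma path_solution_picard_limit:
  assumes x: "cadlag x" and mono: "mono \<phi>" and nonneg: "\<And>y. 0 \<le> \<phi> y"
    and lip: "local_lipschitz (UNIV :: real set) UNIV (\<lambda>_. \<phi>)"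
  shows "path_solution \<phi> x (\<lambda>t. x t - lim (\<lambda>k. picard \<phi> x k t))"
proof -
  have cont: "continuous_on UNIV \<phi>"
    using local_lipschitz_continuous_on[OF lip] by auto
  define Y where "Y = picard \<phi> x"
  define h where "h k s = \<phi> (x s - Y k s)" for k s
  have h: "set_integrable lborel {0..t} (h k)" "h k integrable_on {0..t}"
      "Y (Suc k) t = (LINT s:{0..t}|lborel. h k s)" "Y (Suc k) t = integral {0..t} (h k)"
    if "0 \<le> t" for k t
    using picard_Suc_eq[OF x cont that, of k] set_borel_integral_eq_integral[of "{0..t}" "h k"]
    by (simp_all add: h_def[abs_def] Y_def del: picard.simps)
  show ?thesis
    unfolding path_solution_def
  proof (intro allI impI)
    fix T :: real assume T: "0 \<le> T"
    obtain B where B: "\<forall>s\<in>{0..T}. \<bar>x s\<bar> \<le> B" using cadlag_bounded[OF x] by blast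
    \<comment> \<open>As the iterates are nonnegative, the argument of \<phi> never exceeds
      \<open>B\<close>; integrating the resulting bound \<open>\<phi> B\<close> up to
      \<open>T\<close> gives this constant.\<close>
    define C where "C = T * \<phi> B"
    have C: "0 \<le> C" using T nonneg by (simp add: C_def)
    have Ynn: "0 \<le> Y k t" if "t \<in> {0..T}" for k t
    proof (cases k)
      case (Suc j)
      then show ?thesis using h(2,4)[of t j] that nonneg
        by (auto simp: h_def intro!: Henstock_Kurzweil_Integration.integral_nonneg)
    qed (simp add: Y_def)
    have hB: "h k s \<le> \<phi> B" if "s \<in> {0..T}" for k s
      unfolding h_def using Ynn[OF that, of k] B[rule_format, OF that] by (intro monoD[OF mono]) auto
    have YC: "Y k t \<le> C" if "t \<in> {0..T}" for k t
    proof (cases k)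
      case (Suc j)
      have "Y k t \<le> integral {0..t} (\<lambda>_. \<phi> B)"
        unfolding Suc h(4)[of t j, OF that[unfolded atLeastAtMost_iff, THEN conjunct1]]
        using that by (intro integral_le h hB) auto
      also have "\<dots> \<le> C" using that nonneg[of B] by (auto simp: C_def intro!: mult_right_mono)
      finally show ?thesis .
    qed (use C in \<open>simp add: Y_def\<close>)
    \<comment> \<open>Local Lipschitz continuity carries a time parameter; since \<phi> does not
      depend on it, a one-point compact time set suffices.\<close>
    have "local_lipschitz {0::real} {-B - C..B} (\<lambda>_. \<phi>)"
      by (rule local_lipschitz_subset[OF lip]) auto
    then obtain L where "\<And>t. t \<in> {0::real} \<Longrightarrow> L-lipschitz_on {-B - C..B} \<phi>"
      using local_lipschitz_compact_implies_lipschitz[of "{0::real}" "{-B - C..B}" "\<lambda>_. \<phi>"] by auto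
    then have L: "L-lipschitz_on {-B - C..B} \<phi>" by simp
    have L0: "0 \<le> L" using L by (rule lipschitz_on_nonneg)
    have h_diff: "\<bar>h (Suc k) s - h k s\<bar> \<le> L * \<bar>Y (Suc k) s - Y k s\<bar>" if s: "s \<in> {0..T}" for k s
    proof -
      have "x s - Y j s \<in> {-B - C..B}" for j
        using Ynn[OF s, of j] YC[OF s, of j] B[rule_format, OF s] by auto
      then show ?thesis
        using lipschitz_onD[OF L, of "x s - Y (Suc k) s" "x s - Y k s"]
        by (auto simp: h_def dist_real_def abs_minus_commute)
    qed
    have Y_diff: "\<bar>Y (Suc k) t - Y k t\<bar> \<le> C * (L * t) ^ k / fact k" if "t \<in> {0..T}" for k t
      using that
    proof (induction k arbitrary: t)
      case 0
      then show ?case using Ynn[of t "Suc 0"] YC[of t "Suc 0"] by (simp add: Y_def del: picard.simps(2))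
    next
      case (Suc k)
      then have t: "0 \<le> t" by simp
      \<comment> \<open>The Lipschitz constant times the bound for index \<open>k\<close>; its
        antiderivative is the bound for \<open>Suc k\<close>.\<close>
      let ?p = "\<lambda>s. L * (C * (L * s) ^ k / fact k)"
      have p: "(?p has_integral C * (L * t) ^ Suc k / fact (Suc k) - C * (L * 0) ^ Suc k / fact (Suc k)) {0..t}"
        using t
      proof (rule fundamental_theorem_of_calculus)
        fix s
        have "((\<lambda>s. C * (L * s) ^ Suc k / fact (Suc k)) has_real_derivative
            C * (Suc k * (L * (L * s) ^ (Suc k - Suc 0))) / fact (Suc k)) (at s within {0..t})"
          by (rule DERIV_cdivide[OF DERIV_cmult[OF DERIV_power[OF DERIV_cmult_Id]]])
        moreover have "C * (Suc k * (L * (L * s) ^ (Suc k - Suc 0))) / fact (Suc k) = ?p s"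
          by (simp add: field_simps del: of_nat_Suc)
        ultimately show "((\<lambda>s. C * (L * s) ^ Suc k / fact (Suc k)) has_vector_derivative ?p s) (at s within {0..t})"
          by (simp only: has_real_derivative_iff_has_vector_derivative)
      qed
      have "\<bar>Y (Suc (Suc k)) t - Y (Suc k) t\<bar> = norm (integral {0..t} (\<lambda>s. h (Suc k) s - h k s))"
        using t h by (simp add: Henstock_Kurzweil_Integration.integral_diff)
      also have "\<dots> \<le> integral {0..t} ?p"
      proof (rule Henstock_Kurzweil_Integration.integral_norm_bound_integral)
        show "(\<lambda>s. h (Suc k) s - h k s) integrable_on {0..t}" using h t by (intro integrable_diff)
        show "?p integrable_on {0..t}" using p by blast
        fix s assume "s \<in> {0..t}"
        then have s: "s \<in> {0..T}" using Suc.prems by auto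
        show "norm (h (Suc k) s - h k s) \<le> ?p s"
          using order_trans[OF h_diff[OF s] mult_left_mono[OF Suc.IH[OF s] L0]] by simp
      qed
      also have "\<dots> = C * (L * t) ^ Suc k / fact (Suc k)"
        using integral_unique[OF p] by simp
      finally show ?case .
    qed
    have conv: "(\<lambda>k. Y k t) \<longlonglongrightarrow> lim (\<lambda>k. Y k t)" if t: "t \<in> {0..T}" for t
    proof -
      \<comment> \<open>Domination by an exponential series. The series of differences telescopes to
        the iterates themselves because the zeroth iterate is 0.\<close>
      have "summable (\<lambda>k. C * ((L * t) ^ k / fact k))"
        using summable_exp[of "L * t"] by (intro summable_mult) (simp add: divide_inverse mult.commute)
      then have "summable (\<lambda>k. Y (Suc k) t - Y k t)"
        by (rule summable_comparison_test') (use Y_diff[OF t] in simp)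
      then have "convergent (\<lambda>n. \<Sum>k<n. Y (Suc k) t - Y k t)"
        by (simp add: summable_iff_convergent)
      then have "convergent (\<lambda>n. Y n t)"
        by (subst (asm) sum_lessThan_telescope) (simp add: Y_def)
      then show ?thesis by (simp add: convergent_LIMSEQ_iff)
    qed
    let ?u = "\<lambda>t. x t - lim (\<lambda>k. Y k t)"
    have lim: "(\<lambda>k. h k s) \<longlonglongrightarrow> \<phi> (?u s)" if s: "s \<in> {0..T}" for s
      unfolding h_def
      by (rule continuous_on_tendsto_compose[OF cont]) (auto intro!: tendsto_intros conv s)
    have bd: "\<bar>h k s\<bar> \<le> \<phi> B" if "s \<in> {0..T}" for k s
      using hB[OF that, of k] nonneg by (simp add: h_def)
    \<comment> \<open>The majorant \<open>\<phi> B\<close> does not depend on \<open>k\<close>, so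
      the limit passes under the integral and the recursion becomes the fixed-point
      equation.\<close>
    note dct = set_integral_bounded_convergence[OF h(1)[OF T] bd lim]
    have "(\<lambda>k. Y (Suc k) T) \<longlonglongrightarrow> (LINT s:{0..T}|lborel. \<phi> (?u s))"
      using dct(2) by (simp add: h(3)[OF T])
    moreover have "(\<lambda>k. Y (Suc k) T) \<longlonglongrightarrow> lim (\<lambda>k. Y k T)"
      by (rule LIMSEQ_Suc[OF conv]) (use T in simp)
    ultimately have "lim (\<lambda>k. Y k T) = (LINT s:{0..T}|lborel. \<phi> (?u s))"
      using LIMSEQ_unique by blast
    then show "set_integrable lborel {0..T} (\<lambda>s. \<phi> (x s - lim (\<lambda>k. picard \<phi> x k s))) \<and>
        x T - lim (\<lambda>k. picard \<phi> x k T) =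
        x T - (LINT s:{0..T}|lborel. \<phi> (x s - lim (\<lambda>k. picard \<phi> x k s)))"
      using dct(1) by (simp add: Y_def)
  qed
qed

section \<open>Adaptedness and the passage from paths to processes\<close>

text \<open>Each iterate is a \<open>lim\<close> of finite sums evaluated at times in
  \<open>{0..t}\<close>, where the filtration is contained in \<open>F t\<close>. Such a
  \<open>lim\<close> is measurable even where the sequence diverges, so exceptional paths cause no
  trouble.\<close>

lemma picard_adapted:
  assumes X: "\<And>t. 0 \<le> t \<Longrightarrow> X t \<in> borel_measurable (F t)"
    and F: "filtration \<Omega> F" and \<phi>: "\<phi> \<in> borel_measurable borel" and t: "0 \<le> t"
  shows "(\<lambda>\<omega>. picard \<phi> (\<lambda>s. X s \<omega>) k t) \<in> borel_measurable (F t)"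
  using t
proof (induction k arbitrary: t)
  case (Suc k)
  have "(\<lambda>\<omega>. \<phi> (X s \<omega> - picard \<phi> (\<lambda>s. X s \<omega>) k s)) \<in> borel_measurable (F t)"
    if s: "0 \<le> s" "s \<le> t" for s
  proof -
    have "(\<lambda>\<omega>. X s \<omega> - picard \<phi> (\<lambda>s. X s \<omega>) k s) \<in> borel_measurable (F s)"
      by (intro borel_measurable_diff X Suc.IH s)
    then have "(\<lambda>\<omega>. \<phi> (X s \<omega> - picard \<phi> (\<lambda>s. X s \<omega>) k s)) \<in> borel_measurable (F s)"
      by (rule measurable_compose[OF _ \<phi>])
    moreover have "space (F s) = space (F t)" "sets (F s) \<subseteq> sets (F t)"
      using F s by (auto simp: filtration_def)
    ultimately show ?thesis
      using measurable_mono[of borel borel "F s" "F t"] by auto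
  qed
  moreover have "0 \<le> t * real (Suc i) / real (Suc n) \<and> t * real (Suc i) / real (Suc n) \<le> t"
    if "i < Suc n" for i n
    using that Suc.prems by (auto simp: field_simps intro!: mult_left_mono)
  ultimately show ?case
    unfolding picard.simps riemann_sum_def
    by (intro borel_measurable_lim_metric borel_measurable_times borel_measurable_sum) auto
qed simp

lemma mono_multi_refracted_rate: "multi_refracted_rate \<phi> \<Longrightarrow> mono \<phi>"
  unfolding multi_refracted_rate_def
proof (elim exE conjE, intro monoI)
  fix m :: nat and b \<delta> :: "nat \<Rightarrow> real" and y z :: real
  assume \<delta>: "\<forall>j\<in>{1..m}. 0 < \<delta> j" and yz: "y \<le> z"
    and \<phi>: "\<forall>x. \<phi> x = (\<Sum>j = 1..m. \<delta> j * indicator {b j<..} x)"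
  have "\<delta> j * indicator {b j<..} y \<le> \<delta> j * indicator {b j<..} z" if "j \<in> {1..m}" for j
    using \<delta> yz that by (intro mult_left_mono) (auto simp: indicator_def intro: less_imp_le)
  then show "\<phi> y \<le> \<phi> z" unfolding \<phi>[rule_format] by (rule sum_mono)
qed

theorem proposition20:
  fixes M :: "'a measure" and F :: "real \<Rightarrow> 'a measure" and X :: "real \<Rightarrow> 'a \<Rightarrow> real"
    and x \<gamma> \<sigma> d' :: real and \<nu> :: "real measure" and \<phi> :: "real \<Rightarrow> real"
  assumes levy: "spectrally_negative_levy M F X x \<gamma> \<sigma> \<nu>"
    and mono: "mono \<phi>"
    and lipschitz: "local_lipschitz (UNIV :: real set) UNIV (\<lambda>_. \<phi>)"
    and zero: "\<And>y. y \<le> d' \<Longrightarrow> \<phi> y = 0"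
    and drift: "has_bounded_variation_paths M X \<Longrightarrow> (\<And>y. \<phi> y < levy_drift \<gamma> \<nu>)"
  shows "\<exists>U. sde_solution M F X \<phi> U \<and>
    (\<forall>V. sde_solution M F X \<phi> V \<longrightarrow> indistinguishable M V U) \<and>
    (\<forall>\<phi>s Us. approximating_sequence \<phi> \<phi>s \<longrightarrow>
       (\<forall>n\<ge>1. sde_solution M F X (\<phi>s n) (Us n)) \<longrightarrow>
       (AE \<omega> in M. \<forall>T\<ge>0.
          uniform_limit {0..T} (\<lambda>n t. Us n t \<omega>) (\<lambda>t. U t \<omega>) sequentially))"
proof -
  interpret spectrally_negative_levy M F X x \<gamma> \<sigma> \<nu> by (rule levy)
  have nonneg: "0 \<le> \<phi> y" for y
    using zero[of "min y d'"] monoD[OF mono, of "min y d'" y] by simp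
  have "continuous_on UNIV \<phi>" using local_lipschitz_continuous_on[OF lipschitz] by auto
  then have \<phi>_meas: "\<phi> \<in> borel_measurable borel" by (rule borel_measurable_continuous_onI)
  \<comment> \<open>Defined by the same formula for every \<omega>: adaptedness then holds without
    exception, while the equation holds on the almost sure set of cadlag paths.\<close>
  define U where "U t \<omega> = X t \<omega> - lim (\<lambda>k. picard \<phi> (\<lambda>s. X s \<omega>) k t)" for t \<omega>
  have sde_path: "AE \<omega> in M. path_solution \<eta> (\<lambda>t. X t \<omega>) (\<lambda>t. V t \<omega>)"
    if "sde_solution M F X \<eta> V" for \<eta> V
    using that by (simp add: sde_solution_def path_solution_def)
  have path: "AE \<omega> in M. path_solution \<phi> (\<lambda>t. X t \<omega>) (\<lambda>t. U t \<omega>)"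
    using cadlag_paths
    by eventually_elim (auto simp: U_def intro!: path_solution_picard_limit mono nonneg lipschitz)
  have "sde_solution M F X \<phi> U"
    unfolding sde_solution_def
  proof (intro conjI allI impI)
    fix t :: real assume t: "0 \<le> t"
    show "U t \<in> borel_measurable (F t)"
      unfolding U_def
      by (intro borel_measurable_diff borel_measurable_lim_metric adapted t
          picard_adapted[OF adapted filtration_axioms \<phi>_meas])
  qed (use path in \<open>simp add: path_solution_def\<close>)
  moreover have "indistinguishable M V U" if "sde_solution M F X \<phi> V" for V
    unfolding indistinguishable_def using sde_path[OF that] path
    by eventually_elim (auto intro: path_solution_unique mono)
  moreover have "AE \<omega> in M. \<forall>T\<ge>0.
      uniform_limit {0..T} (\<lambda>n t. Us n t \<omega>) (\<lambda>t. U t \<omega>) sequentially"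
    if approx: "approximating_sequence \<phi> \<phi>s"
      and sol: "\<forall>n\<ge>1. sde_solution M F X (\<phi>s n) (Us n)" for \<phi>s Us
  proof -
    \<comment> \<open>Countably many exceptional null sets are merged into one, so that the
      deterministic limit lemma applies to all \<open>n\<close> and all \<open>T\<close> at
      once.\<close>
    have "AE \<omega> in M. \<forall>n. 1 \<le> n \<longrightarrow> path_solution (\<phi>s n) (\<lambda>t. X t \<omega>) (\<lambda>t. Us n t \<omega>)"
      unfolding AE_all_countable using sol sde_path by auto
    then show ?thesis
      using path cadlag_paths
    proof eventually_elim
      case (elim \<omega>)
      then show ?case
        using approx
        by (auto simp: approximating_sequence_def intro!: path_solutions_uniform_limit
            mono_multi_refracted_rate)
    qed
  qed
  ultimately show ?thesis by blast
qed

end
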